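(* Let $(G,X)$ be a $G$-system with $G$ a discrete infinite amenable group and $(X,d)$ a compact metric space, let $\mathcal{F}$ be a F{\o}lner net in $G$, and let $x\in X$. Suppose that $\mathcal{C}_{\mathcal{F}}(x)$ is S-generic and is not a minimal subset of $(G,X)$, and that the almost periodic points of $(G,X)$ lying in $\mathcal{C}_{\mathcal{F}}(x)$ are dense in $\mathcal{C}_{\mathcal{F}}(x)$. Then there are two distinct points $x_1,x_2\in\mathcal{C}_{\mathcal{F}}(x)$ such that for every $\hat{x}\in\mathcal{C}_{\mathcal{F}}(x)$ and all neighborhoods $U$ of $\hat{x}$, $U_1$ of $x_1$, and $U_2$ of $x_2$ in $X$, there exist $y_1,y_2\in U$ and $g\in G$ with $gy_1\in U_1$ and $gy_2\in U_2$.
   Context: A $G$-system $(G,X)$: $G$ is a discrete infinite amenable group with identity $e$, $(X,d)$ is a compact metric space, and $G$ acts on $X$ from the left by continuous transformations ($ex=x$, $(gf)x=g(fx)$). A set $\Lambda\subseteq X$ is $G$-invariant if $g\Lambda\subseteq\Lambda$ for all $g\in G$. A nonempty closed $G$-invariant set is minimal if the orbit of each of its points is dense in it. A subset $P\subseteq G$ is syndetic if there is a finite $F\subset G$ with $F^{-1}P=\bigcup_{g\in F}g^{-1}P=G$. A point $p\in X$ is almost periodic if $\{g\in G\mid gp\in U\}$ is syndetic for every neighborhood $U$ of $p$. A (left) F{\o}lner net in $G$ is a net $\mathcal{F}=\{F_n\}_{n\in D}$ of (nonempty) finite subsets of $G$ with $\lim_{n\in D}|gF_n\vartriangle F_n|/|F_n|=0$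 for all $g\in G$. For $A\subseteq G$, $\overline{d}_{\mathcal{F}}(A)=\sup\{\alpha \mid \forall m\in D\ \exists n\ge m:\ |A\cap F_n|/|F_n|\ge\alpha\}$ and $\underline{d}_{\mathcal{F}}(A)=\sup\{\alpha \mid \exists m\in D\ \forall n\ge m:\ |A\cap F_n|/|F_n|\ge\alpha\}$; if they coincide the common value is $d_{\mathcal{F}}(A)$. A closed set $C\subseteq X$ is an $\mathcal{F}$-center of attraction of $x$ if $d_{\mathcal{F}}(\{g\in G\mid gx\in B_\epsilon(C)\})=1$ for all $\epsilon>0$, where $B_\epsilon(C)$ is the $\epsilon$-neighborhood of $C$. The minimal one (no proper subset of which is an $\mathcal{F}$-center of attraction of $x$), which exists and is unique, is denoted $\mathcal{C}_{\mathcal{F}}(x)$. A $G$-invariant set $\Lambda\subseteq X$ is S-generic (relative to $\mathcal{F}$) if there is $y\in\Lambda$ with $\Lambda=\mathcal{C}_{\mathcal{F}}(y)$. *)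

theory Defs
  imports "HOL-Analysis.Analysis" "HOL-Algebra.Group_Action"
begin

definition amenable :: "('g, 'b) monoid_scheme \<Rightarrow> bool" where
  "amenable G \<longleftrightarrow>
     (\<exists>\<mu> :: 'g set \<Rightarrow> real.
        \<mu> (carrier G) = 1 \<and>
        (\<forall>A \<subseteq> carrier G. 0 \<le> \<mu> A) \<and>
        (\<forall>A \<subseteq> carrier G. \<forall>B \<subseteq> carrier G. A \<inter> B = {} \<longrightarrow> \<mu> (A \<union> B) = \<mu> A + \<mu> B) \<and>
        (\<forall>g \<in> carrier G. \<forall>A \<subseteq> carrier G. \<mu> (g <#\<^bsub>G\<^esub> A) = \<mu> A))"

text \<open>The phase space is the whole type \<open>'x\<close>; \<open>\<phi> g x\<close> is the point \<open>gx\<close>. The locale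
  \<^locale>\<open>group_action\<close> already contains that \<open>G\<close> is a group.\<close>

locale G_system = group_action G UNIV \<phi>
  for G :: "('g, 'b) monoid_scheme" (structure) and \<phi> :: "'g \<Rightarrow> 'x :: metric_space \<Rightarrow> 'x" +
  assumes infinite_group: "infinite (carrier G)"
    and amenable_group: "amenable G"
    and compact_phase_space: "compact (UNIV :: 'x :: metric_space set)"
    and continuous_action: "g \<in> carrier G \<Longrightarrow> continuous_on UNIV (\<phi> g)"

definition G_invariant :: "('g, 'b) monoid_scheme \<Rightarrow> ('g \<Rightarrow> 'x \<Rightarrow> 'x) \<Rightarrow> 'x set \<Rightarrow> bool" where
  "G_invariant G \<phi> \<Lambda> \<longleftrightarrow> (\<forall>g \<in> carrier G. \<phi> g ` \<Lambda> \<subseteq> \<Lambda>)"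

definition minimal_set ::
    "('g, 'b) monoid_scheme \<Rightarrow> ('g \<Rightarrow> 'x :: metric_space \<Rightarrow> 'x) \<Rightarrow> 'x set \<Rightarrow> bool" where
  "minimal_set G \<phi> \<Lambda> \<longleftrightarrow>
     \<Lambda> \<noteq> {} \<and> closed \<Lambda> \<and> G_invariant G \<phi> \<Lambda> \<and> (\<forall>x \<in> \<Lambda>. \<Lambda> \<subseteq> closure (orbit G \<phi> x))"

definition syndetic :: "('g, 'b) monoid_scheme \<Rightarrow> 'g set \<Rightarrow> bool" where
  "syndetic G P \<longleftrightarrow>
     P \<subseteq> carrier G \<and>
     (\<exists>F \<subseteq> carrier G. finite F \<and> (\<Union>g\<in>F. inv\<^bsub>G\<^esub> g <#\<^bsub>G\<^esub> P) = carrier G)"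

text \<open>A neighborhood of a point is any set having the point in its interior.\<close>

definition almost_periodic ::
    "('g, 'b) monoid_scheme \<Rightarrow> ('g \<Rightarrow> 'x :: metric_space \<Rightarrow> 'x) \<Rightarrow> 'x \<Rightarrow> bool" where
  "almost_periodic G \<phi> p \<longleftrightarrow>
     (\<forall>U. p \<in> interior U \<longrightarrow> syndetic G {g \<in> carrier G. \<phi> g p \<in> U})"

text \<open>Nets are indexed by a set \<open>D\<close> directed by a preorder \<open>leq\<close>, where \<open>leq m n\<close> means \<open>m \<le> n\<close>.\<close>

definition directed_index :: "'d set \<Rightarrow> ('d \<Rightarrow> 'd \<Rightarrow> bool) \<Rightarrow> bool" where
  "directed_index D leq \<longleftrightarrow>
     D \<noteq> {} \<and>
     (\<forall>i\<in>D. leq i i) \<and>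
     (\<forall>i\<in>D. \<forall>j\<in>D. \<forall>k\<in>D. leq i j \<longrightarrow> leq j k \<longrightarrow> leq i k) \<and>
     (\<forall>i\<in>D. \<forall>j\<in>D. \<exists>k\<in>D. leq i k \<and> leq j k)"

definition folner_net ::
    "('g, 'b) monoid_scheme \<Rightarrow> 'd set \<Rightarrow> ('d \<Rightarrow> 'd \<Rightarrow> bool) \<Rightarrow> ('d \<Rightarrow> 'g set) \<Rightarrow> bool" where
  "folner_net G D leq F \<longleftrightarrow>
     directed_index D leq \<and>
     (\<forall>n\<in>D. F n \<subseteq> carrier G \<and> finite (F n) \<and> F n \<noteq> {}) \<and>
     (\<forall>g \<in> carrier G. \<forall>\<epsilon>>0. \<exists>m\<in>D. \<forall>n\<in>D. leq m n \<longrightarrow>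
        real (card (sym_diff (g <#\<^bsub>G\<^esub> F n) (F n))) / real (card (F n)) < \<epsilon>)"

definition upper_density ::
    "'d set \<Rightarrow> ('d \<Rightarrow> 'd \<Rightarrow> bool) \<Rightarrow> ('d \<Rightarrow> 'g set) \<Rightarrow> 'g set \<Rightarrow> real" where
  "upper_density D leq F A =
     Sup {\<alpha>. \<forall>m\<in>D. \<exists>n\<in>D. leq m n \<and> real (card (A \<inter> F n)) / real (card (F n)) \<ge> \<alpha>}"

definition lower_density ::
    "'d set \<Rightarrow> ('d \<Rightarrow> 'd \<Rightarrow> bool) \<Rightarrow> ('d \<Rightarrow> 'g set) \<Rightarrow> 'g set \<Rightarrow> real" where
  "lower_density D leq F A =
     Sup {\<alpha>. \<exists>m\<in>D. \<forall>n\<in>D. leq m n \<longrightarrow> real (card (A \<inter> F n)) / real (card (F n)) \<ge> \<alpha>}"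

definition has_density ::
    "'d set \<Rightarrow> ('d \<Rightarrow> 'd \<Rightarrow> bool) \<Rightarrow> ('d \<Rightarrow> 'g set) \<Rightarrow> 'g set \<Rightarrow> real \<Rightarrow> bool" where
  "has_density D leq F A c \<longleftrightarrow> upper_density D leq F A = c \<and> lower_density D leq F A = c"

text \<open>The union of balls is the \<open>\<epsilon>\<close>-neighborhood of \<open>C\<close>. It is empty for empty \<open>C\<close>
  (unlike \<open>{y. infdist y C < \<epsilon>}\<close>), so the empty set is never a center of attraction.\<close>

definition attraction_center ::
    "('g, 'b) monoid_scheme \<Rightarrow> ('g \<Rightarrow> 'x :: metric_space \<Rightarrow> 'x) \<Rightarrow>
     'd set \<Rightarrow> ('d \<Rightarrow> 'd \<Rightarrow> bool) \<Rightarrow> ('d \<Rightarrow> 'g set) \<Rightarrow> 'x \<Rightarrow> 'x set \<Rightarrow> bool" where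
  "attraction_center G \<phi> D leq F x C \<longleftrightarrow>
     closed C \<and>
     (\<forall>\<epsilon>>0. has_density D leq F {g \<in> carrier G. \<phi> g x \<in> (\<Union>c\<in>C. ball c \<epsilon>)} 1)"

definition minimal_attraction_center ::
    "('g, 'b) monoid_scheme \<Rightarrow> ('g \<Rightarrow> 'x :: metric_space \<Rightarrow> 'x) \<Rightarrow>
     'd set \<Rightarrow> ('d \<Rightarrow> 'd \<Rightarrow> bool) \<Rightarrow> ('d \<Rightarrow> 'g set) \<Rightarrow> 'x \<Rightarrow> 'x set \<Rightarrow> bool" where
  "minimal_attraction_center G \<phi> D leq F x C \<longleftrightarrow>
     attraction_center G \<phi> D leq F x C \<and>
     \<not> (\<exists>C'. C' \<subset> C \<and> attraction_center G \<phi> D leq F x C')"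

text \<open>\<open>\<C>\<^sub>F(x)\<close>. In a \<open>G\<close>-system with a Folner net the minimal center exists and is unique,
  so the description is proper there.\<close>

definition min_center ::
    "('g, 'b) monoid_scheme \<Rightarrow> ('g \<Rightarrow> 'x :: metric_space \<Rightarrow> 'x) \<Rightarrow>
     'd set \<Rightarrow> ('d \<Rightarrow> 'd \<Rightarrow> bool) \<Rightarrow> ('d \<Rightarrow> 'g set) \<Rightarrow> 'x \<Rightarrow> 'x set" where
  "min_center G \<phi> D leq F x = (THE C. minimal_attraction_center G \<phi> D leq F x C)"

definition S_generic ::
    "('g, 'b) monoid_scheme \<Rightarrow> ('g \<Rightarrow> 'x :: metric_space \<Rightarrow> 'x) \<Rightarrow>
     'd set \<Rightarrow> ('d \<Rightarrow> 'd \<Rightarrow> bool) \<Rightarrow> ('d \<Rightarrow> 'g set) \<Rightarrow> 'x set \<Rightarrow> bool" where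
  "S_generic G \<phi> D leq F \<Lambda> \<longleftrightarrow>
     G_invariant G \<phi> \<Lambda> \<and> (\<exists>y\<in>\<Lambda>. \<Lambda> = min_center G \<phi> D leq F y)"

end

theory Submission
  imports Defs
begin

text \<open>
  The minimal center of attraction of \<open>y\<close> consists of the points all of whose neighborhoods are
  visited by \<open>y\<close> with positive upper density; hence if \<open>\<Lambda> = \<C>\<^sub>F(y)\<close> is invariant and contains \<open>y\<close>, the orbit of
  \<open>y\<close> is dense in \<open>\<Lambda>\<close>. If the maps \<open>\<phi> g\<close> restricted to \<open>\<Lambda>\<close> were equicontinuous at \<open>y\<close>, the almost
  periodic points close to \<open>y\<close> would make \<open>y\<close> almost periodic, so \<open>\<Lambda>\<close>, its orbit closure, would be
  minimal. Hence there are \<open>b\<^sub>n \<rightarrow> y\<close> in \<open>\<Lambda>\<close> and \<open>h\<^sub>n\<close> with \<open>h\<^sub>n b\<^sub>n\<close> and \<open>h\<^sub>n y\<close> a fixed distance apart. The limit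
  of a subsequence of these pairs is the pair \<open>(x\<^sub>1, x\<^sub>2)\<close>: it works at \<open>y\<close> by construction and at
  every other point of \<open>\<Lambda>\<close> by translating along the dense orbit of \<open>y\<close>.
\<close>

section \<open>Densities along a net\<close>

text \<open>Encoding the net as a filter makes limits along it ordinary \<open>tendsto\<close>
  statements, so sandwich and sum rules replace manipulations of suprema.\<close>

definition tail_filter :: "'d set \<Rightarrow> ('d \<Rightarrow> 'd \<Rightarrow> bool) \<Rightarrow> 'd filter" where
  "tail_filter D leq = (INF m\<in>D. principal {n\<in>D. leq m n})"

definition density_ratio :: "('d \<Rightarrow> 'g set) \<Rightarrow> 'g set \<Rightarrow> 'd \<Rightarrow> real" where
  "density_ratio F A n = real (card (A \<inter> F n)) / real (card (F n))"

lemma directed_index_nonempty: "directed_index D leq \<Longrightarrow> D \<noteq> {}"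
  by (simp add: directed_index_def)

text \<open>Directedness and transitivity put a third tail inside any two given ones, so the tails
  form a filter base and a single tail decides membership.\<close>

lemma eventually_tail_filter:
  assumes "directed_index D leq"
  shows "eventually P (tail_filter D leq) \<longleftrightarrow> (\<exists>m\<in>D. \<forall>n\<in>D. leq m n \<longrightarrow> P n)"
proof -
  have "\<exists>k\<in>D. principal {n\<in>D. leq k n} \<le> inf (principal {n\<in>D. leq i n}) (principal {n\<in>D. leq j n})"
    if "i \<in> D" "j \<in> D" for i j
  proof -
    obtain k where "k \<in> D" "leq i k" "leq j k"
      using assms \<open>i \<in> D\<close> \<open>j \<in> D\<close> unfolding directed_index_def by blast
    moreover have "leq i n" if "leq i k" "leq k n" "i \<in> D" "k \<in> D" "n \<in> D" for i n
      using assms that unfolding directed_index_def by blast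
    ultimately show ?thesis
      using that by (intro bexI[of _ k]) auto
  qed
  then show ?thesis
    using directed_index_nonempty[OF assms]
    unfolding tail_filter_def
    by (subst eventually_INF_base) (simp_all add: eventually_principal imp_conjL Ball_def)
qed

lemma density_ratio_nonneg: "0 \<le> density_ratio F A n"
  by (simp add: density_ratio_def)

lemma density_ratio_mono:
  assumes "finite (F n)" "A \<subseteq> B"
  shows "density_ratio F A n \<le> density_ratio F B n"
  unfolding density_ratio_def using assms
  by (intro divide_right_mono) (auto intro!: card_mono)

lemma density_ratio_le_1:
  assumes "finite (F n)"
  shows "density_ratio F A n \<le> 1"
  unfolding density_ratio_def using assms
  by (auto simp: divide_le_eq_1 card_mono card_gt_0_iff)

lemma density_ratio_Un_le:
  assumes "finite (F n)"
  shows "density_ratio F (A \<union> B) n \<le> density_ratio F A n + density_ratio F B n"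
proof -
  have "card ((A \<union> B) \<inter> F n) \<le> card (A \<inter> F n) + card (B \<inter> F n)"
    by (metis Int_Un_distrib2 card_Un_le)
  then show ?thesis
    unfolding density_ratio_def add_divide_distrib[symmetric]
    by (intro divide_right_mono) (simp_all flip: of_nat_add)
qed

lemma density_ratio_Diff:
  assumes "finite (F n)" "F n \<noteq> {}" "F n \<subseteq> S"
  shows "density_ratio F (S - A) n = 1 - density_ratio F A n"
proof -
  have "(S - A) \<inter> F n = F n - A \<inter> F n"
    using assms by auto
  moreover have "card (A \<inter> F n) \<le> card (F n)"
    using assms by (auto intro: card_mono)
  ultimately show ?thesis
    using assms by (simp add: density_ratio_def card_Diff_subset of_nat_diff field_simps)
qed

text \<open>Ratios never exceed 1, so lower density 1 alone already forces convergence. Conversely,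
  convergence puts every number below 1 into the set \<open>?L\<close>, and both suprema are
  squeezed to 1.\<close>

lemma has_density_1_iff:
  assumes dir: "directed_index D leq" and fin: "\<And>n. n \<in> D \<Longrightarrow> finite (F n)"
  shows "has_density D leq F A 1 \<longleftrightarrow> (density_ratio F A \<longlongrightarrow> 1) (tail_filter D leq)"
proof
  let ?L = "{\<alpha>. \<exists>m\<in>D. \<forall>n\<in>D. leq m n \<longrightarrow> density_ratio F A n \<ge> \<alpha>}"
  let ?U = "{\<alpha>. \<forall>m\<in>D. \<exists>n\<in>D. leq m n \<and> density_ratio F A n \<ge> \<alpha>}"
  have lower: "lower_density D leq F A = Sup ?L"
    by (simp add: lower_density_def density_ratio_def)
  have upper: "upper_density D leq F A = Sup ?U"
    by (simp add: upper_density_def density_ratio_def)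
  note ne = directed_index_nonempty[OF dir]
  have le1: "density_ratio F A n \<le> 1" if "n \<in> D" for n
    using that by (simp add: density_ratio_le_1 fin)
  \<comment> \<open>Directedness gives an index beyond both \<open>m\<close> and \<open>k\<close>:
    what holds eventually holds frequently.\<close>
  have "?L \<subseteq> ?U"
  proof (intro subsetI CollectI ballI)
    fix \<alpha> m assume "\<alpha> \<in> ?L" and m: "m \<in> D"
    then obtain k where k: "k \<in> D" "\<And>n. n \<in> D \<Longrightarrow> leq k n \<Longrightarrow> density_ratio F A n \<ge> \<alpha>"
      by blast
    obtain n where "n \<in> D" "leq m n" "leq k n"
      using dir m k(1) unfolding directed_index_def by metis
    then show "\<exists>n\<in>D. leq m n \<and> density_ratio F A n \<ge> \<alpha>"
      using k(2) by blast
  qed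
  have U1: "\<alpha> \<le> 1" if "\<alpha> \<in> ?U" for \<alpha>
  proof -
    obtain n where "n \<in> D" "density_ratio F A n \<ge> \<alpha>"
      using \<open>\<alpha> \<in> ?U\<close> ne by blast
    then show ?thesis
      using le1 order_trans by blast
  qed
  \<comment> \<open>A real \<open>Sup\<close> only has its usual meaning on a nonempty set; this
    membership guarantees that.\<close>
  have "0 \<in> ?L"
    using ne by (auto simp: density_ratio_nonneg)
  {
    assume "has_density D leq F A 1"
    then have L: "Sup ?L = 1"
      by (simp add: has_density_def lower)
    show "(density_ratio F A \<longlongrightarrow> 1) (tail_filter D leq)"
    proof (rule order_tendstoI)
      fix a :: real assume "a < 1"
      then obtain \<alpha> where "\<alpha> \<in> ?L" "a < \<alpha>"
        using less_cSupD[of ?L a] \<open>0 \<in> ?L\<close> L by auto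
      then show "\<forall>\<^sub>F n in tail_filter D leq. a < density_ratio F A n"
        unfolding eventually_tail_filter[OF dir] by fastforce
    next
      fix a :: real assume "1 < a"
      then show "\<forall>\<^sub>F n in tail_filter D leq. density_ratio F A n < a"
        unfolding eventually_tail_filter[OF dir] using ne le1 by fastforce
    qed
  }
  {
    assume lim: "(density_ratio F A \<longlongrightarrow> 1) (tail_filter D leq)"
    have L: "\<alpha> \<in> ?L" if "\<alpha> < 1" for \<alpha>
      using order_tendstoD(1)[OF lim that] unfolding eventually_tail_filter[OF dir]
      by (auto intro: less_imp_le)
    \<comment> \<open>Stated for any set between \<open>?L\<close> and \<open>?U\<close>, so that
      one argument serves both densities.\<close>
    have Sup_eq_1: "Sup S = 1" if "?L \<subseteq> S" "S \<subseteq> ?U" for S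
    proof (rule cSup_eq_non_empty)
      show "S \<noteq> {}"
        using that \<open>0 \<in> ?L\<close> by blast
      show "\<alpha> \<le> 1" if "\<alpha> \<in> S" for \<alpha>
        using U1 that \<open>S \<subseteq> ?U\<close> by blast
      show "1 \<le> b" if "\<And>\<alpha>. \<alpha> \<in> S \<Longrightarrow> \<alpha> \<le> b" for b
        by (rule dense_le) (use L that \<open>?L \<subseteq> S\<close> in blast)
    qed
    then show "has_density D leq F A 1"
      unfolding has_density_def lower upper using \<open>?L \<subseteq> ?U\<close> by blast
  }
qed

text \<open>Density zero, phrased as a limit. These sets behave like an ideal, and all later
  arguments about attraction use only that.\<close>

definition negligible_along :: "'d set \<Rightarrow> ('d \<Rightarrow> 'd \<Rightarrow> bool) \<Rightarrow> ('d \<Rightarrow> 'g set) \<Rightarrow> 'g set \<Rightarrow> bool" where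
  "negligible_along D leq F A \<longleftrightarrow> (density_ratio F A \<longlongrightarrow> 0) (tail_filter D leq)"

lemma negligible_along_empty: "negligible_along D leq F {}"
  by (simp add: negligible_along_def density_ratio_def [abs_def])

lemma negligible_along_subset:
  assumes dir: "directed_index D leq" and fin: "\<And>n. n \<in> D \<Longrightarrow> finite (F n)"
    and "negligible_along D leq F B" "A \<subseteq> B"
  shows "negligible_along D leq F A"
  unfolding negligible_along_def
proof (rule tendsto_sandwich[where f = "\<lambda>_. 0" and h = "density_ratio F B"])
  show "\<forall>\<^sub>F n in tail_filter D leq. density_ratio F A n \<le> density_ratio F B n"
    unfolding eventually_tail_filter[OF dir]
    using directed_index_nonempty[OF dir] \<open>A \<subseteq> B\<close> by (auto intro!: density_ratio_mono fin)
qed (use assms in \<open>auto simp: density_ratio_nonneg negligible_along_def\<close>)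

lemma negligible_along_Un:
  assumes dir: "directed_index D leq" and fin: "\<And>n. n \<in> D \<Longrightarrow> finite (F n)"
    and "negligible_along D leq F A" "negligible_along D leq F B"
  shows "negligible_along D leq F (A \<union> B)"
  unfolding negligible_along_def
proof (rule tendsto_sandwich[where f = "\<lambda>_. 0" and h = "\<lambda>n. density_ratio F A n + density_ratio F B n"])
  show "\<forall>\<^sub>F n in tail_filter D leq. density_ratio F (A \<union> B) n \<le> density_ratio F A n + density_ratio F B n"
    unfolding eventually_tail_filter[OF dir]
    using directed_index_nonempty[OF dir] by (auto intro!: density_ratio_Un_le fin)
  show "((\<lambda>n. density_ratio F A n + density_ratio F B n) \<longlongrightarrow> 0) (tail_filter D leq)"
    using tendsto_add[of "density_ratio F A" 0 _ "density_ratio F B" 0] assms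
    by (simp add: negligible_along_def)
qed (auto simp: density_ratio_nonneg)

lemma negligible_along_UN:
  assumes "directed_index D leq" and "\<And>n. n \<in> D \<Longrightarrow> finite (F n)"
    and "finite I" "\<And>i. i \<in> I \<Longrightarrow> negligible_along D leq F (A i)"
  shows "negligible_along D leq F (\<Union>i\<in>I. A i)"
  using assms(3,4)
  by (induction I) (auto simp: negligible_along_empty intro!: negligible_along_Un assms(1,2))

text \<open>Since every \<open>F n\<close> is a nonempty subset of \<open>S\<close>, the ratios of a
  set and of its complement add up to 1. Attraction thereby becomes negligibility of the times spent
  away from the center.\<close>

lemma has_density_1_iff_negligible_along_Diff:
  assumes dir: "directed_index D leq"
    and F: "\<And>n. n \<in> D \<Longrightarrow> finite (F n) \<and> F n \<noteq> {} \<and> F n \<subseteq> S"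
  shows "has_density D leq F A 1 \<longleftrightarrow> negligible_along D leq F (S - A)"
proof -
  have "\<forall>\<^sub>F n in tail_filter D leq. density_ratio F (S - A) n = 1 - density_ratio F A n"
    unfolding eventually_tail_filter[OF dir]
    using directed_index_nonempty[OF dir] density_ratio_Diff[of F _ S A] F by blast
  then have "negligible_along D leq F (S - A) \<longleftrightarrow>
      ((\<lambda>n. 1 - density_ratio F A n) \<longlongrightarrow> 1 - 1) (tail_filter D leq)"
    unfolding negligible_along_def by (simp add: tendsto_cong)
  also have "\<dots> \<longleftrightarrow> (density_ratio F A \<longlongrightarrow> 1) (tail_filter D leq)"
    using tendsto_diff[OF tendsto_const[of 1], of "density_ratio F A" 1 "tail_filter D leq"]
      tendsto_diff[OF tendsto_const[of 1], of "\<lambda>n. 1 - density_ratio F A n" 0 "tail_filter D leq"]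
    by (simp, fast)
  finally show ?thesis
    using F by (subst has_density_1_iff[OF dir]) auto
qed

section \<open>The minimal center of attraction\<close>

context G_system
begin

text \<open>The explicit candidate for the minimal center, shown below to be contained in every
  center of attraction and to be one itself.\<close>

definition return_points :: "'d set \<Rightarrow> ('d \<Rightarrow> 'd \<Rightarrow> bool) \<Rightarrow> ('d \<Rightarrow> 'g set) \<Rightarrow> 'x \<Rightarrow> 'x set" where
  "return_points D leq F x =
     {z. \<forall>\<epsilon>>0. \<not> negligible_along D leq F {g \<in> carrier G. \<phi> g x \<in> ball z \<epsilon>}}"

lemma return_pointsD:
  "z \<in> return_points D leq F x \<Longrightarrow> \<epsilon> > 0 \<Longrightarrow>
    \<not> negligible_along D leq F {g \<in> carrier G. \<phi> g x \<in> ball z \<epsilon>}"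
  unfolding return_points_def by blast

lemma folner_netD:
  assumes "folner_net G D leq F"
  shows "directed_index D leq"
    and "\<And>n. n \<in> D \<Longrightarrow> finite (F n) \<and> F n \<noteq> {} \<and> F n \<subseteq> carrier G"
  using assms unfolding folner_net_def by blast+

lemma attraction_center_iff:
  assumes "folner_net G D leq F"
  shows "attraction_center G \<phi> D leq F x C \<longleftrightarrow>
    closed C \<and> (\<forall>\<epsilon>>0. negligible_along D leq F {g \<in> carrier G. \<phi> g x \<notin> (\<Union>c\<in>C. ball c \<epsilon>)})"
proof -
  have "carrier G - {g \<in> carrier G. P g} = {g \<in> carrier G. \<not> P g}" for P
    by blast
  then show ?thesis
    unfolding attraction_center_def
    by (simp only: has_density_1_iff_negligible_along_Diff[OF folner_netD[OF assms]])
qed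

lemma closed_return_points:
  assumes fol: "folner_net G D leq F"
  shows "closed (return_points D leq F x)"
  unfolding closed_limpt
proof (intro allI impI)
  fix z assume z: "z islimpt return_points D leq F x"
  have "\<not> negligible_along D leq F {g \<in> carrier G. \<phi> g x \<in> ball z \<epsilon>}" if \<epsilon>: "\<epsilon> > 0" for \<epsilon>
  proof
    assume neg: "negligible_along D leq F {g \<in> carrier G. \<phi> g x \<in> ball z \<epsilon>}"
    obtain w where w: "w \<in> return_points D leq F x" "dist w z < \<epsilon> / 2"
      using z \<epsilon> unfolding islimpt_approachable by (meson half_gt_zero)
    have "ball w (\<epsilon> / 2) \<subseteq> ball z \<epsilon>"
      using w(2) by (intro subsetI) (simp, metric)
    then have "negligible_along D leq F {g \<in> carrier G. \<phi> g x \<in> ball w (\<epsilon> / 2)}"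
      using folner_netD[OF fol] by (intro negligible_along_subset[OF _ _ neg]) auto
    then show False
      using return_pointsD[OF w(1), of "\<epsilon> / 2"] \<epsilon> by simp
  qed
  then show "z \<in> return_points D leq F x"
    by (simp add: return_points_def)
qed

text \<open>A compactness argument: each point outside the \<open>\<epsilon>\<close>-neighborhood
  has a ball with negligible visiting times, finitely many such balls cover the outside, and finite
  unions of negligible sets are negligible.\<close>

lemma return_points_attraction_center:
  assumes fol: "folner_net G D leq F"
  shows "attraction_center G \<phi> D leq F x (return_points D leq F x)"
proof -
  let ?C = "return_points D leq F x"
  have "negligible_along D leq F {g \<in> carrier G. \<phi> g x \<notin> (\<Union>c\<in>?C. ball c \<epsilon>)}" if "\<epsilon> > 0" for \<epsilon>
  proof -
    define K where "K = - (\<Union>c\<in>?C. ball c \<epsilon>)"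
    have "compact K"
      unfolding K_def using compact_phase_space
      by (metis closed_Compl compact_Int_closed inf_top_left open_UN open_ball)
    have "\<exists>r>0. negligible_along D leq F {g \<in> carrier G. \<phi> g x \<in> ball z r}" if "z \<in> K" for z
    proof -
      have "z \<notin> ?C"
        using that \<open>\<epsilon> > 0\<close> unfolding K_def by (metis ComplD UN_I centre_in_ball)
      then show ?thesis
        by (auto simp: return_points_def)
    qed
    then obtain r where r: "\<And>z. z \<in> K \<Longrightarrow> r z > 0"
      "\<And>z. z \<in> K \<Longrightarrow> negligible_along D leq F {g \<in> carrier G. \<phi> g x \<in> ball z (r z)}"
      by metis
    have "K \<subseteq> (\<Union>z\<in>K. ball z (r z))"
      using r(1) by auto
    then obtain Z where Z: "Z \<subseteq> K" "finite Z" "K \<subseteq> (\<Union>z\<in>Z. ball z (r z))"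
      using compactE_image[OF \<open>compact K\<close>, of K "\<lambda>z. ball z (r z)"] by auto
    have "negligible_along D leq F (\<Union>z\<in>Z. {g \<in> carrier G. \<phi> g x \<in> ball z (r z)})"
      using Z r(2) folner_netD[OF fol] by (intro negligible_along_UN) auto
    moreover have "{g \<in> carrier G. \<phi> g x \<notin> (\<Union>c\<in>?C. ball c \<epsilon>)}
        \<subseteq> (\<Union>z\<in>Z. {g \<in> carrier G. \<phi> g x \<in> ball z (r z)})"
      using Z(3) unfolding K_def by blast
    ultimately show ?thesis
      using folner_netD[OF fol] by (blast intro: negligible_along_subset)
  qed
  then show ?thesis
    using closed_return_points[OF fol] by (auto simp: attraction_center_iff[OF fol])
qed

text \<open>A point off the closed set \<open>C\<close> has a ball of some radius \<open>e\<close>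
  missing \<open>C\<close>. Its ball of radius \<open>e / 2\<close> then avoids the
  \<open>e / 2\<close>-neighborhood of \<open>C\<close>, so visits there are negligible.\<close>

lemma return_points_subset_attraction_center:
  assumes fol: "folner_net G D leq F" and C: "attraction_center G \<phi> D leq F x C"
  shows "return_points D leq F x \<subseteq> C"
proof (rule ccontr)
  assume "\<not> ?thesis"
  then obtain z where z: "z \<in> return_points D leq F x" "z \<notin> C"
    by blast
  have C': "closed C" "\<And>\<epsilon>. \<epsilon> > 0 \<Longrightarrow>
      negligible_along D leq F {g \<in> carrier G. \<phi> g x \<notin> (\<Union>c\<in>C. ball c \<epsilon>)}"
    using C by (auto simp: attraction_center_iff[OF fol])
  then obtain e where e: "e > 0" "ball z e \<inter> C = {}"
    using z(2) by (metis Compl_iff disjoint_eq_subset_Compl open_Compl open_contains_ball)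
  have "y \<notin> (\<Union>c\<in>C. ball c (e / 2))" if "y \<in> ball z (e / 2)" for y
  proof
    assume "y \<in> (\<Union>c\<in>C. ball c (e / 2))"
    then obtain c where "c \<in> C" "dist c y < e / 2"
      by auto
    moreover have "dist z c < e"
      using that \<open>dist c y < e / 2\<close> by (simp, metric)
    ultimately show False
      using e(2) by auto
  qed
  then have "{g \<in> carrier G. \<phi> g x \<in> ball z (e / 2)}
      \<subseteq> {g \<in> carrier G. \<phi> g x \<notin> (\<Union>c\<in>C. ball c (e / 2))}"
    by blast
  then have "negligible_along D leq F {g \<in> carrier G. \<phi> g x \<in> ball z (e / 2)}"
    using negligible_along_subset C'(2)[of "e / 2"] e(1) folner_netD[OF fol]
    by (metis (no_types, lifting) half_gt_zero)
  then show False
    using return_pointsD[OF z(1), of "e / 2"] e(1) by simp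
qed

text \<open>Being the least center of attraction, \<open>return_points\<close> is minimal, and any
  other minimal center would properly contain it; so the description in \<open>min_center\<close> is
  uniquely satisfied.\<close>

lemma min_center_eq_return_points:
  assumes fol: "folner_net G D leq F"
  shows "min_center G \<phi> D leq F x = return_points D leq F x"
  unfolding min_center_def minimal_attraction_center_def
  using return_points_attraction_center[OF fol] return_points_subset_attraction_center[OF fol]
  by (intro the_equality) blast+

text \<open>A ball never visited has an empty, hence negligible, set of visiting times.\<close>

lemma min_center_subset_closure_orbit:
  assumes fol: "folner_net G D leq F"
  shows "min_center G \<phi> D leq F x \<subseteq> closure (orbit G \<phi> x)"
proof
  fix z assume "z \<in> min_center G \<phi> D leq F x"
  then have z: "\<not> negligible_along D leq F {g \<in> carrier G. \<phi> g x \<in> ball z e}" if "e > 0" for e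
    using that by (simp add: min_center_eq_return_points[OF fol] return_points_def)
  show "z \<in> closure (orbit G \<phi> x)"
    unfolding closure_approachable
  proof (intro allI impI)
    fix e :: real assume "e > 0"
    then have "{g \<in> carrier G. \<phi> g x \<in> ball z e} \<noteq> {}"
      using z negligible_along_empty by metis
    then show "\<exists>y\<in>orbit G \<phi> x. dist y z < e"
      by (auto simp: orbit_def dist_commute)
  qed
qed

section \<open>Almost periodic points\<close>

lemma act_inv: "g \<in> carrier G \<Longrightarrow> \<phi> (inv g) (\<phi> g x) = x"
  by (simp add: orbit_sym_aux)

lemma act_mult: "g \<in> carrier G \<Longrightarrow> h \<in> carrier G \<Longrightarrow> \<phi> (g \<otimes> h) x = \<phi> g (\<phi> h x)"
  by (simp add: composition_rule)

lemma group_G: "group G"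
  using group_hom by (simp add: group_hom_def)

lemma open_act_vimage: "g \<in> carrier G \<Longrightarrow> open V \<Longrightarrow> open (\<phi> g -` V)"
  using continuous_action by (simp add: continuous_on_open_vimage)

lemma closed_act_vimage: "g \<in> carrier G \<Longrightarrow> closed V \<Longrightarrow> closed (\<phi> g -` V)"
  using continuous_action by (simp add: continuous_on_closed_vimage)

lemma syndetic_mono:
  assumes "syndetic G P" "P \<subseteq> Q" "Q \<subseteq> carrier G"
  shows "syndetic G Q"
proof -
  interpret group G by (rule group_G)
  obtain S where S: "S \<subseteq> carrier G" "finite S" "(\<Union>g\<in>S. inv g <# P) = carrier G"
    using assms unfolding syndetic_def by blast
  have "(\<Union>g\<in>S. inv g <# P) \<subseteq> (\<Union>g\<in>S. inv g <# Q)"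
    using assms(2) unfolding l_coset_def by blast
  moreover have "(\<Union>g\<in>S. inv g <# Q) \<subseteq> carrier G"
    using S(1) assms(3) by (intro UN_least l_coset_subset_G) auto
  ultimately have "(\<Union>g\<in>S. inv g <# Q) = carrier G"
    unfolding S(3) by (rule subset_antisym[rotated])
  then show ?thesis
    using S(1,2) assms(3) unfolding syndetic_def by (intro conjI exI[of _ S])
qed

text \<open>Cancelling the inverses in \<open>inv g <# P\<close> gives the usable form: finitely
  many translations suffice to bring any group element into \<open>P\<close>.\<close>

lemma syndetic_translateE:
  assumes "syndetic G P"
  obtains S where "S \<subseteq> carrier G" "finite S" "\<And>h. h \<in> carrier G \<Longrightarrow> \<exists>g\<in>S. g \<otimes> h \<in> P"
proof -
  interpret group G by (rule group_G)
  obtain S where S: "S \<subseteq> carrier G" "finite S" "(\<Union>g\<in>S. inv g <# P) = carrier G"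
    and P: "P \<subseteq> carrier G"
    using assms unfolding syndetic_def by blast
  have "\<exists>g\<in>S. g \<otimes> h \<in> P" if h: "h \<in> carrier G" for h
  proof -
    obtain g p where g: "g \<in> S" "p \<in> P" "h = inv g \<otimes> p"
      using h S(3) unfolding l_coset_def by blast
    then have "g \<otimes> h = p"
      using S(1) P by (metis inv_solve_left' subsetD h)
    then show ?thesis
      using g by blast
  qed
  then show ?thesis
    using S that by blast
qed

lemma orbit_subset_invariant:
  assumes "G_invariant G \<phi> \<Lambda>" "x \<in> \<Lambda>"
  shows "orbit G \<phi> x \<subseteq> \<Lambda>"
  using assms by (auto simp: orbit_def G_invariant_def)

lemma orbit_act_subset:
  assumes "g \<in> carrier G"
  shows "\<phi> g ` orbit G \<phi> x \<subseteq> orbit G \<phi> x"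
proof -
  interpret group G by (rule group_G)
  show ?thesis
    using assms by (force simp: orbit_def simp flip: act_mult)
qed

lemma closure_orbit_invariant: "G_invariant G \<phi> (closure (orbit G \<phi> x))"
  unfolding G_invariant_def
proof
  fix g assume g: "g \<in> carrier G"
  show "\<phi> g ` closure (orbit G \<phi> x) \<subseteq> closure (orbit G \<phi> x)"
    using g continuous_on_subset[OF continuous_action[OF g]] orbit_act_subset[OF g, of x] closure_subset
    by (intro image_closure_subset) auto
qed

text \<open>Syndetic return times cover the orbit of \<open>y\<close> by finitely many preimages of
  a ball around \<open>y\<close>. Their union is closed, so it also contains \<open>z\<close>, and
  some \<open>g\<close> takes \<open>z\<close> close to \<open>y\<close>.\<close>

lemma almost_periodic_recurrent:
  assumes "almost_periodic G \<phi> y" and z: "z \<in> closure (orbit G \<phi> y)"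
  shows "y \<in> closure (orbit G \<phi> z)"
  unfolding closure_approachable
proof (intro allI impI)
  fix e :: real assume e: "e > 0"
  \<comment> \<open>The closed ball makes the preimages closed; halving the radius recovers the
    strict bound at the end.\<close>
  have "y \<in> interior (cball y (e / 2))"
    using e by (meson ball_subset_cball centre_in_ball half_gt_zero interior_maximal open_ball subsetD)
  then have "syndetic G {g \<in> carrier G. \<phi> g y \<in> cball y (e / 2)}"
    using assms(1) unfolding almost_periodic_def by blast
  then obtain S where S: "S \<subseteq> carrier G" "finite S"
    "\<And>h. h \<in> carrier G \<Longrightarrow> \<exists>g\<in>S. g \<otimes> h \<in> {g \<in> carrier G. \<phi> g y \<in> cball y (e / 2)}"
    using syndetic_translateE by blast
  have "orbit G \<phi> y \<subseteq> (\<Union>g\<in>S. \<phi> g -` cball y (e / 2))"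
  proof
    fix w assume "w \<in> orbit G \<phi> y"
    then obtain h where h: "h \<in> carrier G" "w = \<phi> h y"
      by (auto simp: orbit_def)
    then obtain g where g: "g \<in> S" "\<phi> (g \<otimes> h) y \<in> cball y (e / 2)"
      using S(3) by blast
    then have "w \<in> \<phi> g -` cball y (e / 2)"
      using h S(1) act_mult[of g h y] by auto
    then show "w \<in> (\<Union>g\<in>S. \<phi> g -` cball y (e / 2))"
      using g(1) by blast
  qed
  moreover have "closed (\<Union>g\<in>S. \<phi> g -` cball y (e / 2))"
    using S(1,2) closed_act_vimage[OF _ closed_cball] by (intro closed_UN) blast+
  ultimately have "z \<in> (\<Union>g\<in>S. \<phi> g -` cball y (e / 2))"
    using z closure_minimal by blast
  then obtain g where "g \<in> S" "dist y (\<phi> g z) \<le> e / 2"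
    by auto
  then show "\<exists>w\<in>orbit G \<phi> z. dist w y < e"
    using S(1) e by (intro bexI[of _ "\<phi> g z"]) (auto simp: orbit_def dist_commute)
qed

lemma closure_orbit_almost_periodic_minimal:
  assumes "almost_periodic G \<phi> y"
  shows "minimal_set G \<phi> (closure (orbit G \<phi> y))"
proof -
  have "closure (orbit G \<phi> y) \<noteq> {}"
    using orbit_refl[of y] by auto
  moreover have "closure (orbit G \<phi> y) \<subseteq> closure (orbit G \<phi> z)" if "z \<in> closure (orbit G \<phi> y)" for z
    using almost_periodic_recurrent[OF assms that] orbit_subset_invariant[OF closure_orbit_invariant]
    by (simp add: closure_minimal)
  ultimately show ?thesis
    by (simp add: minimal_set_def closure_orbit_invariant)
qed

text \<open>Under equicontinuity a nearby almost periodic point \<open>p\<close> shadows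
  \<open>y\<close> for all group elements at once, so the return times of \<open>p\<close> to a
  small ball are return times of \<open>y\<close> to \<open>U\<close>.\<close>

lemma almost_periodic_if_equicontinuous_at:
  assumes equi: "\<And>\<epsilon>. \<epsilon> > 0 \<Longrightarrow> \<exists>\<delta>>0. \<forall>w\<in>\<Lambda>. dist w y < \<delta> \<longrightarrow> (\<forall>g\<in>carrier G. dist (\<phi> g w) (\<phi> g y) < \<epsilon>)"
    and dense: "y \<in> closure {p \<in> \<Lambda>. almost_periodic G \<phi> p}"
  shows "almost_periodic G \<phi> y"
  unfolding almost_periodic_def
proof (intro allI impI)
  fix U assume "y \<in> interior U"
  then obtain e where e: "e > 0" "ball y e \<subseteq> U"
    by (meson mem_interior)
  then obtain \<delta> where \<delta>: "\<delta> > 0"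
    "\<And>w g. w \<in> \<Lambda> \<Longrightarrow> dist w y < \<delta> \<Longrightarrow> g \<in> carrier G \<Longrightarrow> dist (\<phi> g w) (\<phi> g y) < e / 2"
    using equi[of "e / 2"] by auto
  \<comment> \<open>The bound \<open>\<delta>\<close> gives the shadowing; the bound
    \<open>e / 2\<close> makes \<open>ball y (e / 2)\<close> a neighborhood of
    \<open>p\<close>.\<close>
  obtain p where p: "p \<in> \<Lambda>" "almost_periodic G \<phi> p" "dist p y < min \<delta> (e / 2)"
    using dense \<delta>(1) e(1) unfolding closure_approachable
    by (metis (mono_tags, lifting) half_gt_zero mem_Collect_eq min_less_iff_conj)
  then have "p \<in> interior (ball y (e / 2))"
    by (simp add: dist_commute)
  then have "syndetic G {g \<in> carrier G. \<phi> g p \<in> ball y (e / 2)}"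
    using p(2) unfolding almost_periodic_def by blast
  moreover have "\<phi> g y \<in> U" if g: "g \<in> carrier G" "\<phi> g p \<in> ball y (e / 2)" for g
  proof -
    have "dist (\<phi> g p) (\<phi> g y) < e / 2"
      using \<delta>(2) p g by simp
    then have "\<phi> g y \<in> ball y e"
      using g(2) by (simp, metric)
    then show ?thesis
      using e by blast
  qed
  ultimately show "syndetic G {g \<in> carrier G. \<phi> g y \<in> U}"
    by (auto elim!: syndetic_mono)
qed

section \<open>Sensitive pairs\<close>

text \<open>The pair is a limit of images of \<open>y\<close> and of points approaching it. In the
  conclusion \<open>y\<close> itself is one of the two source points, which is what the construction
  yields.\<close>

lemma separated_limit_pair:
  assumes "closed \<Lambda>" "G_invariant G \<phi> \<Lambda>" "y \<in> \<Lambda>" "\<epsilon> > 0"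
    and sep: "\<And>\<delta>. \<delta> > 0 \<Longrightarrow> \<exists>w\<in>\<Lambda>. dist w y < \<delta> \<and> (\<exists>g\<in>carrier G. \<epsilon> \<le> dist (\<phi> g w) (\<phi> g y))"
  obtains x1 x2 where "x1 \<in> \<Lambda>" "x2 \<in> \<Lambda>" "x1 \<noteq> x2"
    "\<And>U U1 U2. open U \<Longrightarrow> open U1 \<Longrightarrow> open U2 \<Longrightarrow> y \<in> U \<Longrightarrow> x1 \<in> U1 \<Longrightarrow> x2 \<in> U2 \<Longrightarrow>
       \<exists>y1\<in>U. \<exists>g\<in>carrier G. \<phi> g y1 \<in> U1 \<and> \<phi> g y \<in> U2"
proof -
  have "\<forall>n. \<exists>w g. w \<in> \<Lambda> \<and> dist w y < inverse (real (Suc n)) \<and> g \<in> carrier G \<and>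
      \<epsilon> \<le> dist (\<phi> g w) (\<phi> g y)"
    using sep 
    by (meson inverse_positive_iff_positive of_nat_0_less_iff zero_less_Suc)
  then obtain b h where b: "\<And>n. b n \<in> \<Lambda>" "\<And>n. dist (b n) y < inverse (real (Suc n))"
    and h: "\<And>n. h n \<in> carrier G" "\<And>n. \<epsilon> \<le> dist (\<phi> (h n) (b n)) (\<phi> (h n) y)"
    by metis
  have "b \<longlonglongrightarrow> y"
    using b(2) by (intro metric_tendsto_imp_tendsto[OF LIMSEQ_inverse_real_of_nat] always_eventually)
      (auto intro: less_imp_le)
  have "compact \<Lambda>"
    using compact_phase_space \<open>closed \<Lambda>\<close> by (metis compact_Int_closed inf_top_left)
  then have "compact (\<Lambda> \<times> \<Lambda>)"
    by (simp add: compact_Times)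
  \<comment> \<open>Compactness is applied to pairs so that one subsequence \<open>r\<close> serves
    both coordinates.\<close>
  moreover have "(\<phi> (h n) (b n), \<phi> (h n) y) \<in> \<Lambda> \<times> \<Lambda>" for n
    using assms(2,3) b(1) h(1) unfolding G_invariant_def by blast
  ultimately obtain l r where l: "l \<in> \<Lambda> \<times> \<Lambda>" and r: "strict_mono r"
    and lim: "((\<lambda>n. (\<phi> (h n) (b n), \<phi> (h n) y)) \<circ> r) \<longlonglongrightarrow> l"
    unfolding compact_def by meson
  have lim1: "(\<lambda>n. \<phi> (h (r n)) (b (r n))) \<longlonglongrightarrow> fst l"
    and lim2: "(\<lambda>n. \<phi> (h (r n)) y) \<longlonglongrightarrow> snd l"
    using tendsto_fst[OF lim] tendsto_snd[OF lim] by (simp_all add: o_def)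
  \<comment> \<open>The non-strict separation survives the limit.\<close>
  have "\<epsilon> \<le> dist (fst l) (snd l)"
    using h(2) by (intro LIMSEQ_le_const[OF tendsto_dist[OF lim1 lim2]]) auto
  then have "fst l \<noteq> snd l"
    using \<open>\<epsilon> > 0\<close> by auto
  moreover have "\<exists>y1\<in>U. \<exists>g\<in>carrier G. \<phi> g y1 \<in> U1 \<and> \<phi> g y \<in> U2"
    if "open U" "open U1" "open U2" "y \<in> U" "fst l \<in> U1" "snd l \<in> U2" for U U1 U2
  proof -
    have "(\<lambda>n. b (r n)) \<longlonglongrightarrow> y"
      using LIMSEQ_subseq_LIMSEQ[OF \<open>b \<longlonglongrightarrow> y\<close> r] by (simp add: o_def)
    then have "\<forall>\<^sub>F n in sequentially. b (r n) \<in> U \<and> \<phi> (h (r n)) (b (r n)) \<in> U1 \<and> \<phi> (h (r n)) y \<in> U2"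
      using that lim1 lim2 by (intro eventually_conj topological_tendstoD)
    then obtain n where "b (r n) \<in> U" "\<phi> (h (r n)) (b (r n)) \<in> U1" "\<phi> (h (r n)) y \<in> U2"
      using eventually_happens'[OF sequentially_bot] by blast
    then show ?thesis
      using h(1) by blast
  qed
  ultimately show thesis
    using l that[of "fst l" "snd l"] by auto
qed

end

theorem theorem1p5:
  fixes G :: "('g, 'b) monoid_scheme"
    and \<phi> :: "'g \<Rightarrow> 'x :: metric_space \<Rightarrow> 'x"
    and D :: "'d set" and leq :: "'d \<Rightarrow> 'd \<Rightarrow> bool" and F :: "'d \<Rightarrow> 'g set"
    and x :: 'x
  assumes "G_system G \<phi>"
    and "folner_net G D leq F"
    and "S_generic G \<phi> D leq F (min_center G \<phi> D leq F x)"
    and "\<not> minimal_set G \<phi> (min_center G \<phi> D leq F x)"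
    and "min_center G \<phi> D leq F x
           \<subseteq> closure {p \<in> min_center G \<phi> D leq F x. almost_periodic G \<phi> p}"
  shows "\<exists>x1 \<in> min_center G \<phi> D leq F x. \<exists>x2 \<in> min_center G \<phi> D leq F x. x1 \<noteq> x2 \<and>
           (\<forall>xh \<in> min_center G \<phi> D leq F x. \<forall>U U1 U2.
              xh \<in> interior U \<longrightarrow> x1 \<in> interior U1 \<longrightarrow> x2 \<in> interior U2 \<longrightarrow>
              (\<exists>y1\<in>U. \<exists>y2\<in>U. \<exists>g \<in> carrier G. \<phi> g y1 \<in> U1 \<and> \<phi> g y2 \<in> U2))"
proof -
  interpret G_system G \<phi> by fact
  let ?\<Lambda> = "min_center G \<phi> D leq F x"
  note fol = assms(2)
  obtain y where inv: "G_invariant G \<phi> ?\<Lambda>" and y: "y \<in> ?\<Lambda>" and \<Lambda>: "?\<Lambda> = min_center G \<phi> D leq F y"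
    using assms(3) unfolding S_generic_def by blast
  have closed: "closed ?\<Lambda>"
    by (simp add: min_center_eq_return_points[OF fol] closed_return_points[OF fol])
  have dense: "?\<Lambda> \<subseteq> closure (orbit G \<phi> y)"
    using min_center_subset_closure_orbit[OF fol, of y] \<Lambda> by simp
  then have "?\<Lambda> = closure (orbit G \<phi> y)"
    using closure_minimal[OF orbit_subset_invariant[OF inv y] closed] by blast
  then have "\<not> almost_periodic G \<phi> y"
    using closure_orbit_almost_periodic_minimal assms(4) by metis
  \<comment> \<open>Density of almost periodic points leaves failure of equicontinuity at
    \<open>y\<close> as the only possibility.\<close>
  then obtain \<epsilon> where \<epsilon>: "\<epsilon> > 0"
    "\<And>\<delta>. \<delta> > 0 \<Longrightarrow> \<exists>w\<in>?\<Lambda>. dist w y < \<delta> \<and> (\<exists>g\<in>carrier G. \<epsilon> \<le> dist (\<phi> g w) (\<phi> g y))"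
    using almost_periodic_if_equicontinuous_at[of ?\<Lambda> y] assms(5) y by (meson not_less subsetD)
  obtain x1 x2 where x12: "x1 \<in> ?\<Lambda>" "x2 \<in> ?\<Lambda>" "x1 \<noteq> x2"
    and pair: "\<And>U U1 U2. open U \<Longrightarrow> open U1 \<Longrightarrow> open U2 \<Longrightarrow> y \<in> U \<Longrightarrow> x1 \<in> U1 \<Longrightarrow> x2 \<in> U2 \<Longrightarrow>
       \<exists>y1\<in>U. \<exists>g\<in>carrier G. \<phi> g y1 \<in> U1 \<and> \<phi> g y \<in> U2"
    by (rule separated_limit_pair[OF closed inv y \<epsilon>]) blast+
  have "\<exists>y1\<in>U. \<exists>y2\<in>U. \<exists>g \<in> carrier G. \<phi> g y1 \<in> U1 \<and> \<phi> g y2 \<in> U2"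
    if xh: "xh \<in> ?\<Lambda>" "xh \<in> interior U" and U12: "x1 \<in> interior U1" "x2 \<in> interior U2" for xh U U1 U2
  proof -
    have "interior U \<inter> orbit G \<phi> y \<noteq> {}"
      using xh dense open_Int_closure_eq_empty[OF open_interior] by blast
    then obtain h where h: "h \<in> carrier G" "\<phi> h y \<in> interior U"
      by (auto simp: orbit_def)
    \<comment> \<open>The pair property at \<open>y\<close> is applied to the neighborhood of
      \<open>y\<close> pulled back from \<open>U\<close> by \<open>h\<close>.\<close>
    then obtain w g where w: "\<phi> h w \<in> interior U" and g: "g \<in> carrier G"
      "\<phi> g w \<in> interior U1" "\<phi> g y \<in> interior U2"
      using pair[of "\<phi> h -` interior U" "interior U1" "interior U2"] U12
      by (auto simp: open_act_vimage)
    interpret group G by (rule group_G)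
    \<comment> \<open>Undoing \<open>h\<close> before applying \<open>g\<close> moves the pair
      \<open>w\<close>, \<open>y\<close> to the witnesses \<open>\<phi> h w\<close>,
      \<open>\<phi> h y\<close> in \<open>U\<close>.\<close>
    have "\<phi> (g \<otimes>\<^bsub>G\<^esub> inv\<^bsub>G\<^esub> h) (\<phi> h v) = \<phi> g v" for v
      using g(1) h(1) by (simp add: act_mult act_inv)
    then have "\<phi> (g \<otimes>\<^bsub>G\<^esub> inv\<^bsub>G\<^esub> h) (\<phi> h w) \<in> U1" "\<phi> (g \<otimes>\<^bsub>G\<^esub> inv\<^bsub>G\<^esub> h) (\<phi> h y) \<in> U2"
      using g interior_subset by auto
    moreover have "g \<otimes>\<^bsub>G\<^esub> inv\<^bsub>G\<^esub> h \<in> carrier G" "\<phi> h w \<in> U" "\<phi> h y \<in> U"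
      using g(1) h w interior_subset by auto
    ultimately show ?thesis
      by blast
  qed
  then show ?thesis
    using x12 by blast
qed

end
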